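(* Let $G$ be a finite group of order $n$. Then the enhanced power graph $\mathcal{G}_e(G)$ is Eulerian if and only if $n$ is odd.
   Context: For a group $G$, the enhanced power graph $\mathcal{G}_e(G)$ is the simple undirected graph with vertex set $G$ in which two distinct vertices $x,y$ are adjacent if there exists $z\in G$ with $x=z^m$ and $y=z^n$ for some $m,n\in\mathbb{N}$. A graph is Eulerian if it has a closed trail containing all its edges; for connected graphs this is equivalent to every vertex having even degree. *)

theory Defs
  imports "HOL-Algebra.Algebra"
begin

text \<open>A simple undirected graph is a pair of a vertex set and a set of edges, each edge being
  a set of two distinct vertices. (The graphs of \<open>Graph_Theory\<close> are directed: viewed as a
  symmetric digraph, a closed Euler trail would run through every undirected edge twice.)\<close>

type_synonym 'a ugraph = "'a set \<times> 'a set set"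

definition simple_ugraph :: "'a ugraph \<Rightarrow> bool" where
  "simple_ugraph \<Gamma> \<longleftrightarrow>
     (\<forall>e \<in> snd \<Gamma>. \<exists>u \<in> fst \<Gamma>. \<exists>v \<in> fst \<Gamma>. u \<noteq> v \<and> e = {u, v})"

text \<open>A walk is given by the nonempty list of the vertices it visits; the one-vertex list is the
  walk of length 0, which is a closed trail.\<close>

fun walk_edges :: "'a list \<Rightarrow> 'a set list" where
  "walk_edges (u # v # p) = {u, v} # walk_edges (v # p)"
| "walk_edges _ = []"

definition walk :: "'a ugraph \<Rightarrow> 'a list \<Rightarrow> bool" where
  "walk \<Gamma> p \<longleftrightarrow> p \<noteq> [] \<and> set p \<subseteq> fst \<Gamma> \<and> set (walk_edges p) \<subseteq> snd \<Gamma>"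

definition trail :: "'a ugraph \<Rightarrow> 'a list \<Rightarrow> bool" where
  "trail \<Gamma> p \<longleftrightarrow> walk \<Gamma> p \<and> distinct (walk_edges p)"

definition closed_trail :: "'a ugraph \<Rightarrow> 'a list \<Rightarrow> bool" where
  "closed_trail \<Gamma> p \<longleftrightarrow> trail \<Gamma> p \<and> hd p = last p"

definition eulerian :: "'a ugraph \<Rightarrow> bool" where
  "eulerian \<Gamma> \<longleftrightarrow> (\<exists>p. closed_trail \<Gamma> p \<and> snd \<Gamma> \<subseteq> set (walk_edges p))"

text \<open>The exponents range over all natural numbers including 0. For a finite group this gives the
  same graph as positive exponents, since the identity is then also a positive power of every
  element.\<close>

definition enhanced_power_graph :: "('a, 'b) monoid_scheme \<Rightarrow> 'a ugraph" where
  "enhanced_power_graph G =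
     (carrier G,
      {{x, y} | x y. x \<in> carrier G \<and> y \<in> carrier G \<and> x \<noteq> y \<and>
         (\<exists>z \<in> carrier G. \<exists>(m :: nat) (n :: nat). x = z [^]\<^bsub>G\<^esub> m \<and> y = z [^]\<^bsub>G\<^esub> n)})"

lemma simple_ugraph_enhanced_power_graph: "simple_ugraph (enhanced_power_graph G)"
  unfolding simple_ugraph_def enhanced_power_graph_def by auto

end

theory Submission
  imports Defs
begin

text \<open>
  A longest trail in a finite graph all of whose degrees are even is closed, and if the graph is
  connected a closed trail missing an edge can be rotated so as to be extended by such an edge.
  In the enhanced power graph, the identity is adjacent to every other vertex and
  thus has degree \<open>n - 1\<close>, so \<open>n\<close> is odd if the graph is Eulerian. Conversely, if \<open>n\<close> is odd then
  inversion acts on the closed neighbourhood of any vertex with the identity as its only fixed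
  point, so that closed neighbourhoods are odd and degrees are even.
\<close>

section \<open>Degrees, adjacency and edges of simple graphs\<close>

text \<open>Incident edges are counted instead of neighbours, so that the degree can be compared
  directly with the edges of a trail.\<close>

definition vertex_degree :: "'a ugraph \<Rightarrow> 'a \<Rightarrow> nat" where
  "vertex_degree \<Gamma> v = card {e \<in> snd \<Gamma>. v \<in> e}"

definition adjacency :: "'a ugraph \<Rightarrow> 'a rel" where
  "adjacency \<Gamma> = {(u, v). {u, v} \<in> snd \<Gamma>}"

lemma finite_edges:
  assumes "simple_ugraph \<Gamma>" and "finite (fst \<Gamma>)"
  shows "finite (snd \<Gamma>)"
proof (rule finite_subset)
  show "snd \<Gamma> \<subseteq> Pow (fst \<Gamma>)"
    using assms(1) by (fastforce simp: simple_ugraph_def)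
qed (use assms(2) in simp)

lemma simple_ugraph_edgeD:
  assumes "simple_ugraph \<Gamma>" and "{u, v} \<in> snd \<Gamma>"
  shows "u \<noteq> v" and "u \<in> fst \<Gamma>" and "v \<in> fst \<Gamma>"
proof -
  obtain a b where "a \<in> fst \<Gamma>" "b \<in> fst \<Gamma>" "a \<noteq> b" "{u, v} = {a, b}"
    using assms unfolding simple_ugraph_def by blast
  then show "u \<noteq> v" and "u \<in> fst \<Gamma>" and "v \<in> fst \<Gamma>"
    by (auto simp: doubleton_eq_iff)
qed

section \<open>Parity of incidences along walks\<close>

text \<open>The cut vertex \<open>v\<close> ends one piece and starts the other, so no edge at the
  cut is lost.\<close>

lemma walk_edges_append:
  "walk_edges (xs @ v # ys) = walk_edges (xs @ [v]) @ walk_edges (v # ys)"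
  by (induction xs rule: walk_edges.induct) auto

lemma length_walk_edges: "length (walk_edges p) = length p - 1"
  by (induction p rule: walk_edges.induct) auto

lemma Union_walk_edges_subset: "\<Union> (set (walk_edges p)) \<subseteq> set p"
  by (induction p rule: walk_edges.induct) auto

text \<open>Prefixing the edge \<open>{u, w}\<close> moves the head from \<open>w\<close> to
  \<open>u\<close> and changes the parity exactly if \<open>v\<close> is one of these two distinct
  vertices.\<close>

lemma odd_incidences_walk:
  assumes "simple_ugraph \<Gamma>" and "walk \<Gamma> p"
  shows "odd (length (filter (\<lambda>e. v \<in> e) (walk_edges p))) \<longleftrightarrow> (hd p = v) \<noteq> (last p = v)"
  using assms(2)
proof (induction p rule: walk_edges.induct)
  case (1 u w p)
  then have "{u, w} \<in> snd \<Gamma>" and "walk \<Gamma> (w # p)"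
    by (auto simp: walk_def)
  moreover have "u \<noteq> w"
    using simple_ugraph_edgeD(1)[OF assms(1) \<open>{u, w} \<in> snd \<Gamma>\<close>] .
  ultimately show ?case
    using 1(1) by auto
qed (auto simp: walk_def)

text \<open>Edges of a trail do not repeat, so counting list entries amounts to counting
  edges.\<close>

lemma odd_incidences_trail:
  assumes "simple_ugraph \<Gamma>" and "trail \<Gamma> p"
  shows "odd (card {e \<in> set (walk_edges p). v \<in> e}) \<longleftrightarrow> (hd p = v) \<noteq> (last p = v)"
proof -
  have "{e \<in> set (walk_edges p). v \<in> e} = {e. v \<in> e} \<inter> set (walk_edges p)"
    by blast
  then show ?thesis
    using odd_incidences_walk[OF assms(1), of p v] assms(2)
      distinct_length_filter[of "walk_edges p" "\<lambda>e. v \<in> e"]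
    unfolding trail_def by metis
qed

lemma even_degree_if_eulerian:
  assumes "simple_ugraph \<Gamma>" and "eulerian \<Gamma>"
  shows "even (vertex_degree \<Gamma> v)"
proof -
  obtain p where p: "closed_trail \<Gamma> p" "snd \<Gamma> \<subseteq> set (walk_edges p)"
    using assms(2) unfolding eulerian_def by blast
  then have "snd \<Gamma> = set (walk_edges p)"
    unfolding closed_trail_def trail_def walk_def by blast
  then show ?thesis
    using odd_incidences_trail[OF assms(1), of p v] p(1)
    unfolding vertex_degree_def closed_trail_def by metis
qed

section \<open>Extending and rotating trails\<close>

lemma trail_snoc:
  assumes "simple_ugraph \<Gamma>" and "trail \<Gamma> p"
    and "{last p, w} \<in> snd \<Gamma>" and "{last p, w} \<notin> set (walk_edges p)"
  shows "trail \<Gamma> (p @ [w])"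
proof -
  have "p \<noteq> []"
    using assms(2) by (simp add: trail_def walk_def)
  then have p_w: "p @ [w] = butlast p @ last p # [w]"
    by (metis append_Cons append_Nil append_assoc append_butlast_last_id)
  have "walk_edges (p @ [w]) = walk_edges p @ [{last p, w}]"
    unfolding p_w walk_edges_append[of "butlast p" "last p" "[w]"]
    using \<open>p \<noteq> []\<close> by simp
  then show ?thesis
    using assms simple_ugraph_edgeD(3)[OF assms(1,3)] by (auto simp: trail_def walk_def)
qed

text \<open>Cut \<open>p\<close> at \<open>v\<close> and swap the two pieces: they can be glued at
  the common end \<open>hd p\<close>, and the result ends at \<open>v\<close>.\<close>

lemma rotate_closed_trail:
  assumes "closed_trail \<Gamma> p" and "v \<in> set p"
  obtains q where "trail \<Gamma> q" and "last q = v" and "length q = length p"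
    and "set (walk_edges q) = set (walk_edges p)"
proof -
  obtain xs ys where p: "p = xs @ v # ys"
    using assms(2) by (meson split_list)
  obtain h t where ht: "xs @ [v] = h # t"
    by (cases "xs @ [v]") auto
  have h: "h = hd p"
    using ht p by (cases xs) auto
  \<comment> \<open>As \<open>p\<close> is closed, \<open>v # ys\<close> ends in \<open>h\<close>;
    dropping that copy keeps \<open>h\<close> from occurring twice at the junction.\<close>
  define zs where "zs = butlast (v # ys)"
  have zs: "v # ys = zs @ [h]"
    using assms(1) p h unfolding zs_def closed_trail_def
    by (metis append_butlast_last_id last_appendR list.distinct(1))
  have edges_p: "walk_edges p = walk_edges (h # t) @ walk_edges (zs @ [h])"
    using walk_edges_append[of xs v ys] unfolding p ht zs .
  have edges_q: "walk_edges (zs @ h # t) = walk_edges (zs @ [h]) @ walk_edges (h # t)"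
    by (rule walk_edges_append)
  have sets: "set (zs @ h # t) = set p"
    using arg_cong[OF ht, of set] arg_cong[OF zs, of set] p by auto
  show thesis
  proof
    show "trail \<Gamma> (zs @ h # t)"
      using assms(1) sets edges_p edges_q
      by (auto simp: closed_trail_def trail_def walk_def)
    show "last (zs @ h # t) = v"
      using ht by (metis last_appendR last_snoc list.distinct(1))
    show "length (zs @ h # t) = length p"
      using arg_cong[OF ht, of length] arg_cong[OF zs, of length] p by simp
    show "set (walk_edges (zs @ h # t)) = set (walk_edges p)"
      using edges_p edges_q by auto
  qed
qed

text \<open>Otherwise the set of visited vertices would be closed under adjacency, hence contain all
  vertices by connectedness, and every edge would be used.\<close>

lemma unused_edge_at_trail:
  assumes "simple_ugraph \<Gamma>" and "walk \<Gamma> p"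
    and conn: "\<And>u v. u \<in> fst \<Gamma> \<Longrightarrow> v \<in> fst \<Gamma> \<Longrightarrow> (u, v) \<in> (adjacency \<Gamma>)\<^sup>*"
    and "\<not> snd \<Gamma> \<subseteq> set (walk_edges p)"
  obtains v w where "v \<in> set p" and "{v, w} \<in> snd \<Gamma>" and "{v, w} \<notin> set (walk_edges p)"
proof (rule ccontr)
  note unused = that
  assume "\<not> thesis"
  then have used: "{v, w} \<in> set (walk_edges p)" if "v \<in> set p" "{v, w} \<in> snd \<Gamma>" for v w
    using that unused by blast
  have visited: "v \<in> set p" if "(hd p, v) \<in> (adjacency \<Gamma>)\<^sup>*" for v
    using that
  proof (induction rule: rtrancl_induct)
    case base
    then show ?case
      using assms(2) by (simp add: walk_def)
  next
    case (step y z)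
    then have "{y, z} \<in> set (walk_edges p)"
      using used by (simp add: adjacency_def)
    then show ?case
      using Union_walk_edges_subset[of p] by blast
  qed
  obtain e where e: "e \<in> snd \<Gamma>" "e \<notin> set (walk_edges p)"
    using assms(4) by blast
  then obtain a b where ab: "a \<in> fst \<Gamma>" "e = {a, b}"
    using assms(1) unfolding simple_ugraph_def by blast
  have "hd p \<in> fst \<Gamma>"
    using assms(2) by (auto simp: walk_def)
  then have "a \<in> set p"
    using visited conn ab(1) by blast
  then show False
    using used e ab(2) by blast
qed

section \<open>Euler's theorem for finite connected graphs\<close>

text \<open>The vertex set must be nonempty because even a walk of length 0 visits a vertex.\<close>

theorem eulerian_iff_even_degrees:
  assumes simple: "simple_ugraph \<Gamma>" and fin: "finite (fst \<Gamma>)" and "fst \<Gamma> \<noteq> {}"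
    and conn: "\<And>u v. u \<in> fst \<Gamma> \<Longrightarrow> v \<in> fst \<Gamma> \<Longrightarrow> (u, v) \<in> (adjacency \<Gamma>)\<^sup>*"
  shows "eulerian \<Gamma> \<longleftrightarrow> (\<forall>v \<in> fst \<Gamma>. even (vertex_degree \<Gamma> v))"
proof
  assume "eulerian \<Gamma>"
  then show "\<forall>v \<in> fst \<Gamma>. even (vertex_degree \<Gamma> v)"
    using even_degree_if_eulerian[OF simple] by blast
next
  assume even: "\<forall>v \<in> fst \<Gamma>. even (vertex_degree \<Gamma> v)"
  \<comment> \<open>A trail has one vertex entry more than edges; the strict bound adds another
    1.\<close>
  have bound: "length p < card (snd \<Gamma>) + 2" if "trail \<Gamma> p" for p
  proof -
    have "length (walk_edges p) \<le> card (snd \<Gamma>)"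
      using that finite_edges[OF simple fin] unfolding trail_def walk_def
      by (metis card_mono distinct_card)
    then show ?thesis
      by (simp add: length_walk_edges)
  qed
  obtain v where "v \<in> fst \<Gamma>"
    using \<open>fst \<Gamma> \<noteq> {}\<close> by blast
  then have "trail \<Gamma> [v]"
    by (simp add: trail_def walk_def)
  then obtain p where p: "trail \<Gamma> p" and longest: "\<And>q. trail \<Gamma> q \<Longrightarrow> length q \<le> length p"
    using bound ex_has_greatest_nat[of "trail \<Gamma>" "[v]" length "card (snd \<Gamma>) + 2"]
    by (metis less_imp_le)
  \<comment> \<open>Stated for all trails as long as \<open>p\<close>, so that it also applies to
    rotations of \<open>p\<close>.\<close>
  have maximal: "{last q, w} \<in> set (walk_edges q)"
    if "trail \<Gamma> q" "length q = length p" "{last q, w} \<in> snd \<Gamma>" for q w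
    using longest[OF trail_snoc[OF simple that(1,3)]] that(2) by force
  have "walk \<Gamma> p"
    using p by (simp add: trail_def)
  have closed: "closed_trail \<Gamma> p"
  proof (rule ccontr)
    assume "\<not> closed_trail \<Gamma> p"
    then have "odd (card {e \<in> set (walk_edges p). last p \<in> e})"
      using odd_incidences_trail[OF simple p, of "last p"] p by (simp add: closed_trail_def)
    \<comment> \<open>By maximality all edges at the end of \<open>p\<close> are used, so the odd
      count is the degree of that vertex.\<close>
    moreover have "{e \<in> set (walk_edges p). last p \<in> e} = {e \<in> snd \<Gamma>. last p \<in> e}"
    proof (intro subset_antisym subsetI)
      fix e
      assume e: "e \<in> {e \<in> snd \<Gamma>. last p \<in> e}"
      then obtain a b where "e = {a, b}"
        using simple unfolding simple_ugraph_def by blast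
      then obtain w where "e = {last p, w}"
        using e by (auto simp: insert_commute)
      then show "e \<in> {e \<in> set (walk_edges p). last p \<in> e}"
        using maximal[OF p] e by simp
    qed (use \<open>walk \<Gamma> p\<close> in \<open>auto simp: walk_def\<close>)
    moreover have "last p \<in> fst \<Gamma>"
      using \<open>walk \<Gamma> p\<close> by (auto simp: walk_def)
    ultimately show False
      using even by (simp add: vertex_degree_def)
  qed
  have "snd \<Gamma> \<subseteq> set (walk_edges p)"
  proof (rule ccontr)
    assume "\<not> snd \<Gamma> \<subseteq> set (walk_edges p)"
    then obtain v w where vw: "v \<in> set p" "{v, w} \<in> snd \<Gamma>" "{v, w} \<notin> set (walk_edges p)"
      using unused_edge_at_trail[OF simple \<open>walk \<Gamma> p\<close> conn] by blast
    obtain q where "trail \<Gamma> q" "last q = v" "length q = length p"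
      "set (walk_edges q) = set (walk_edges p)"
      using rotate_closed_trail[OF closed vw(1)] .
    then show False
      using maximal[of q w] vw(2,3) by simp
  qed
  then show "eulerian \<Gamma>"
    using closed unfolding eulerian_def by blast
qed

section \<open>Involutions and groups of odd order\<close>

text \<open>The set falls into pairs \<open>{a, f a}\<close>; the induction removes one pair at a
  time.\<close>

lemma even_card_involution:
  assumes "finite A" and "\<And>x. x \<in> A \<Longrightarrow> f x \<in> A" and "\<And>x. x \<in> A \<Longrightarrow> f (f x) = x"
    and "\<And>x. x \<in> A \<Longrightarrow> f x \<noteq> x"
  shows "even (card A)"
  using assms
proof (induction "card A" arbitrary: A rule: less_induct)
  case less
  show ?case
  proof (cases "A = {}")
    case False
    then obtain a where a: "a \<in> A"
      by blast
    have fa: "f a \<in> A" "f a \<noteq> a"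
      using less.prems a by auto
    have card_A: "card A = card (A - {a, f a}) + 2"
      using card_Diff_subset[of "{a, f a}" A] card_mono[of A "{a, f a}"] a fa less.prems(1)
      by simp
    have "even (card (A - {a, f a}))"
    proof (rule less.hyps)
      show "card (A - {a, f a}) < card A"
        using card_A by simp
      show "f x \<in> A - {a, f a}" if "x \<in> A - {a, f a}" for x
        using that less.prems(2,3) a by (metis Diff_iff insert_iff singletonD)
    qed (use less.prems in auto)
    then show ?thesis
      using card_A by simp
  qed simp
qed

text \<open>Such a \<open>y\<close> squares to the identity, while its odd power
  \<open>2 * k + 1\<close> is both \<open>y\<close> and the identity.\<close>

lemma (in group) inv_eq_self_odd_order:
  assumes "odd (order G)" and "y \<in> carrier G" and "inv y = y"
  shows "y = \<one>"
proof -
  obtain k where k: "order G = 2 * k + 1"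
    using assms(1) by (rule oddE)
  have "y [^] (2 :: nat) = \<one>"
    using assms(2,3) r_inv[of y] by (simp add: numeral_2_eq_2)
  then have "y [^] (2 * k) = \<one>"
    using nat_pow_pow[OF assms(2), of 2 k] by simp
  then have "y [^] (2 * k + 1) = y"
    using assms(2) by simp
  then show ?thesis
    using pow_order_eq_1[OF assms(2)] k by simp
qed

section \<open>Closed neighbourhoods in the enhanced power graph\<close>

context group
begin

text \<open>Keeping \<open>x\<close> itself in the set lets inversion act on it.\<close>

definition closed_nbhd :: "'a \<Rightarrow> 'a set" where
  "closed_nbhd x = {y \<in> carrier G.
     \<exists>z \<in> carrier G. \<exists>(m :: nat) (k :: nat). x = z [^] m \<and> y = z [^] k}"

lemma edges_enhanced_power_graph:
  "snd (enhanced_power_graph G) =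
     {{x, y} | x y. x \<in> carrier G \<and> y \<in> closed_nbhd x \<and> x \<noteq> y}"
  unfolding enhanced_power_graph_def closed_nbhd_def by (simp only: snd_conv mem_Collect_eq conj_ac)

lemma closed_nbhd_sym:
  assumes "x \<in> carrier G" and "y \<in> closed_nbhd x"
  shows "x \<in> closed_nbhd y"
  using assms by (auto simp: closed_nbhd_def)

lemma self_in_closed_nbhd:
  assumes "x \<in> carrier G"
  shows "x \<in> closed_nbhd x"
proof -
  have "x = x [^] (1 :: nat)"
    using assms by simp
  then show ?thesis
    using assms unfolding closed_nbhd_def by blast
qed

lemma one_in_closed_nbhd:
  assumes "x \<in> carrier G"
  shows "\<one> \<in> closed_nbhd x"
proof -
  have "x = x [^] (1 :: nat)" and "\<one> = x [^] (0 :: nat)"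
    using assms by simp_all
  then show ?thesis
    using assms unfolding closed_nbhd_def by blast
qed

lemma closed_nbhd_one: "closed_nbhd \<one> = carrier G"
proof
  show "closed_nbhd \<one> \<subseteq> carrier G"
    unfolding closed_nbhd_def by blast
  show "carrier G \<subseteq> closed_nbhd \<one>"
    using closed_nbhd_sym one_in_closed_nbhd by blast
qed

lemma inv_in_closed_nbhd:
  assumes "finite (carrier G)" and "y \<in> closed_nbhd x"
  shows "inv y \<in> closed_nbhd x"
proof -
  obtain z m k where z: "z \<in> carrier G" "x = z [^] (m :: nat)" "y = z [^] (k :: nat)"
    using assms(2) unfolding closed_nbhd_def by blast
  \<comment> \<open>Positivity of the order makes the natural subtraction exact, so
    \<open>k * (order G - 1)\<close> can serve as the exponent \<open>-k\<close>.\<close>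
  have "order G \<noteq> 0"
    using assms(1) order_gt_0_iff_finite by simp
  then have "k * (order G - 1) + k = order G * k"
    by (cases "order G") auto
  then have "z [^] (k * (order G - 1)) \<otimes> y = \<one>"
    using z(1,3) pow_order_eq_1[OF z(1)] nat_pow_pow[OF z(1), of "order G" k]
    by (simp add: nat_pow_mult)
  then have "inv y = z [^] (k * (order G - 1))"
    using z by (intro inv_equality) auto
  then show ?thesis
    using z unfolding closed_nbhd_def by blast
qed

text \<open>Inversion pairs off the elements other than the identity, which contributes the
  remaining one.\<close>

lemma odd_card_closed_nbhd:
  assumes "finite (carrier G)" and "odd (order G)" and "x \<in> carrier G"
  shows "odd (card (closed_nbhd x))"
proof -
  have carrier: "closed_nbhd x \<subseteq> carrier G"
    unfolding closed_nbhd_def by blast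
  then have fin: "finite (closed_nbhd x)"
    using assms(1) by (rule finite_subset)
  have "even (card (closed_nbhd x - {\<one>}))"
  proof (rule even_card_involution)
    fix y
    assume "y \<in> closed_nbhd x - {\<one>}"
    then have y: "y \<in> closed_nbhd x" "y \<in> carrier G" "y \<noteq> \<one>"
      using carrier by auto
    then show "inv y \<in> closed_nbhd x - {\<one>}"
      using inv_in_closed_nbhd[OF assms(1)] inv_eq_1_iff by simp
    show "inv (inv y) = y"
      using y(2) by simp
    show "inv y \<noteq> y"
      using inv_eq_self_odd_order[OF assms(2) y(2)] y(3) by blast
  qed (use fin in simp)
  then show ?thesis
    using card_Suc_Diff1[OF fin one_in_closed_nbhd[OF assms(3)]] by (metis even_Suc)
qed

lemma degree_enhanced_power_graph:
  assumes "finite (carrier G)" and "x \<in> carrier G"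
  shows "Suc (vertex_degree (enhanced_power_graph G) x) = card (closed_nbhd x)"
proof -
  \<comment> \<open>Each edge at \<open>x\<close> is determined by its other endpoint.\<close>
  have "{e \<in> snd (enhanced_power_graph G). x \<in> e} = (\<lambda>y. {x, y}) ` (closed_nbhd x - {x})"
    unfolding edges_enhanced_power_graph
    using assms(2) closed_nbhd_sym by (auto simp: insert_commute)
  moreover have "inj_on (\<lambda>y. {x, y}) (closed_nbhd x - {x})"
    by (auto simp: inj_on_def doubleton_eq_iff)
  ultimately have "vertex_degree (enhanced_power_graph G) x = card (closed_nbhd x - {x})"
    by (simp add: vertex_degree_def card_image)
  moreover have "finite (closed_nbhd x)"
    using assms(1) unfolding closed_nbhd_def by simp
  ultimately show ?thesis
    using card_Suc_Diff1[OF _ self_in_closed_nbhd[OF assms(2)]] by simp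
qed

lemma connected_enhanced_power_graph:
  assumes "u \<in> carrier G" and "v \<in> carrier G"
  shows "(u, v) \<in> (adjacency (enhanced_power_graph G))\<^sup>*"
proof -
  have edge: "{w, \<one>} \<in> snd (enhanced_power_graph G)" if "w \<in> carrier G" "w \<noteq> \<one>" for w
    unfolding edges_enhanced_power_graph using that one_in_closed_nbhd by blast
  \<comment> \<open>The identity is the hub of all paths; from the identity itself the path has
    length 0, as there are no loops.\<close>
  have "(u, \<one>) \<in> (adjacency (enhanced_power_graph G))\<^sup>*"
    using edge[OF assms(1)] by (cases "u = \<one>") (auto simp: adjacency_def)
  moreover have "(\<one>, v) \<in> (adjacency (enhanced_power_graph G))\<^sup>*"
    using edge[OF assms(2)] by (cases "v = \<one>") (auto simp: adjacency_def insert_commute)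
  ultimately show ?thesis
    by (rule rtrancl_trans)
qed

end

theorem theorem4p2:
  fixes G :: "('a, 'b) monoid_scheme" and n :: nat
  assumes "group G" and "finite (carrier G)" and "order G = n"
  shows "eulerian (enhanced_power_graph G) \<longleftrightarrow> odd n"
proof -
  interpret group G
    by (rule assms(1))
  have vertices: "fst (enhanced_power_graph G) = carrier G"
    by (simp add: enhanced_power_graph_def)
  have "even (vertex_degree (enhanced_power_graph G) x) \<longleftrightarrow> odd (card (closed_nbhd x))"
    if "x \<in> carrier G" for x
    using degree_enhanced_power_graph[OF assms(2) that] by (metis even_Suc)
  then have "eulerian (enhanced_power_graph G) \<longleftrightarrow> (\<forall>x \<in> carrier G. odd (card (closed_nbhd x)))"
    using eulerian_iff_even_degrees[OF simple_ugraph_enhanced_power_graph[of G]]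
      assms(2) connected_enhanced_power_graph one_closed
    unfolding vertices by blast
  \<comment> \<open>The condition at the identity alone already forces \<open>n\<close> to be
    odd.\<close>
  moreover have "card (closed_nbhd \<one>\<^bsub>G\<^esub>) = n"
    using assms(3) by (simp add: closed_nbhd_one order_def)
  ultimately show ?thesis
    using odd_card_closed_nbhd[OF assms(2)] assms(3) one_closed by metis
qed

end
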